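(* Let $A, C \in \mathbb{C}^{n\times n}$ be Hermitian matrices with $C$ indefinite. Then the 2D eigenvalue problem of $(A,C)$ has at least one 2D-eigenvalue $(\mu,\lambda)\in\mathbb{R}^2$.
   Context: A Hermitian matrix is indefinite if it has at least one positive and at least one negative eigenvalue. A pair $(\mu,\lambda)\in\mathbb{R}\times\mathbb{R}$ is a 2D-eigenvalue of $(A,C)$ if there exists $x\in\mathbb{C}^n$ such that $(A-\mu C)x=\lambda x$, $x^HCx=0$ and $x^Hx=1$. Both $\mu$ and $\lambda$ are required to be real. *)

theory Defs
  imports
    Complex_Main
    "Jordan_Normal_Form.Char_Poly"
    "Jordan_Normal_Form.Schur_Decomposition"
begin

definition hermitian_mat :: "complex mat \<Rightarrow> bool" where
  "hermitian_mat A \<longleftrightarrow> mat_adjoint A = A"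

text \<open>Intended for Hermitian matrices only, all of whose eigenvalues are real.\<close>

definition indefinite_mat :: "complex mat \<Rightarrow> bool" where
  "indefinite_mat C \<longleftrightarrow>
     (\<exists>a::real. a > 0 \<and> eigenvalue C (complex_of_real a)) \<and>
     (\<exists>b::real. b < 0 \<and> eigenvalue C (complex_of_real b))"

text \<open>The scalar product \<open>v \<bullet>c w\<close> conjugates its second argument, so
  \<open>(C *\<^sub>v x) \<bullet>c x\<close> is \<open>x\<^sup>H C x\<close> and \<open>x \<bullet>c x\<close> is \<open>x\<^sup>H x\<close>.\<close>

definition eigenvalue_2D :: "complex mat \<Rightarrow> complex mat \<Rightarrow> real \<times> real \<Rightarrow> bool" where
  "eigenvalue_2D A C = (\<lambda>(\<mu>, l).
     \<exists>x \<in> carrier_vec (dim_row A).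
       (A - complex_of_real \<mu> \<cdot>\<^sub>m C) *\<^sub>v x = complex_of_real l \<cdot>\<^sub>v x \<and>
       (C *\<^sub>v x) \<bullet>c x = 0 \<and>
       x \<bullet>c x = 1)"

end

theory Submission
  imports Defs "HOL-Analysis.Function_Topology"
begin

text \<open>Let \<open>x\<close> minimise \<open>x\<^sup>H A x\<close> over the unit vectors with \<open>x\<^sup>H C x = 0\<close>, a compact set that is
  nonempty because \<open>C\<close> is indefinite, and let \<open>l\<close> be the minimum. Lagrange multipliers are not
  available when \<open>C x = 0\<close>. Instead, the form of \<open>A - l I\<close> is nonnegative on the isotropic vectors
  of \<open>C\<close>, so by the S-lemma \<open>A - \<mu> C - l I\<close> is positive semidefinite for some real \<open>\<mu>\<close>. Its form
  vanishes at \<open>x\<close>, hence \<open>x\<close> lies in its kernel.\<close>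

section \<open>Hermitian matrices and their quadratic forms\<close>

text \<open>Taking the real part makes values of the form comparable by the order on the reals; for
  Hermitian \<open>M\<close> it loses nothing, by \<open>hermitian_form_real\<close>. The squared
  norm is treated as the form of \<open>1\<^sub>m n\<close>.\<close>

definition qform :: "complex mat \<Rightarrow> complex vec \<Rightarrow> real" where
  "qform M x = Re ((M *\<^sub>v x) \<bullet>c x)"

lemma hermitian_mat_iff:
  assumes "M \<in> carrier_mat n n"
  shows "hermitian_mat M \<longleftrightarrow> (\<forall>i<n. \<forall>j<n. M $$ (j, i) = cnj (M $$ (i, j)))"
proof -
  have adj: "mat_adjoint M = mat n n (\<lambda>(i, j). cnj (M $$ (j, i)))"
    using assms unfolding mat_adjoint_def by (intro eq_matI) (auto simp: mat_of_rows_def)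
  show ?thesis
  proof
    assume "hermitian_mat M"
    then have "M = mat n n (\<lambda>(i, j). cnj (M $$ (j, i)))"
      unfolding hermitian_mat_def adj ..
    then have "cnj (M $$ (i, j)) = M $$ (j, i)" if "i < n" "j < n" for i j
      using that by (metis (no_types, lifting) index_mat(1) case_prod_conv)
    then show "\<forall>i<n. \<forall>j<n. M $$ (j, i) = cnj (M $$ (i, j))" by metis
  next
    assume h: "\<forall>i<n. \<forall>j<n. M $$ (j, i) = cnj (M $$ (i, j))"
    show "hermitian_mat M"
      unfolding hermitian_mat_def adj
    proof (rule eq_matI)
      fix i j assume "i < dim_row M" "j < dim_col M"
      then have "i < n" "j < n" using assms by auto
      moreover from this have "M $$ (i, j) = cnj (M $$ (j, i))" using h by blast
      ultimately show "mat n n (\<lambda>(i, j). cnj (M $$ (j, i))) $$ (i, j) = M $$ (i, j)" by simp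
    qed (use assms in auto)
  qed
qed

text \<open>The coefficient is real, hence fixed by conjugation. Differences such as
  \<open>A - l I\<close> are later written as sums with a negative coefficient to fit this
  shape.\<close>

lemma hermitian_mat_add_smult:
  assumes "M \<in> carrier_mat n n" "N \<in> carrier_mat n n" "hermitian_mat M" "hermitian_mat N"
  shows "hermitian_mat (M + complex_of_real r \<cdot>\<^sub>m N)"
proof -
  have c: "M + complex_of_real r \<cdot>\<^sub>m N \<in> carrier_mat n n" using assms by simp
  have M: "M $$ (j, i) = cnj (M $$ (i, j))" if "i < n" "j < n" for i j
    using assms(3) hermitian_mat_iff[OF assms(1)] that by blast
  have N: "N $$ (j, i) = cnj (N $$ (i, j))" if "i < n" "j < n" for i j
    using assms(4) hermitian_mat_iff[OF assms(2)] that by blast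
  have d: "dim_row M = n" "dim_col M = n" "dim_row N = n" "dim_col N = n" using assms by auto
  show ?thesis
    unfolding hermitian_mat_iff[OF c]
    by (simp add: d del: complex_cnj_cancel_iff) (metis M N)
qed

lemma hermitian_mat_one: "hermitian_mat (1\<^sub>m n)"
  using hermitian_mat_iff[of "1\<^sub>m n" n] by auto

lemma sesquilinear_sum:
  assumes "M \<in> carrier_mat n n" "x \<in> carrier_vec n" "y \<in> carrier_vec n"
  shows "(M *\<^sub>v x) \<bullet>c y = (\<Sum>i<n. \<Sum>j<n. M $$ (i, j) * x $ j * cnj (y $ i))"
  using assms
  by (auto simp: scalar_prod_def atLeast0LessThan sum_distrib_right intro!: sum.cong)

lemma hermitian_form_commute:
  assumes "M \<in> carrier_mat n n" "hermitian_mat M" "x \<in> carrier_vec n" "y \<in> carrier_vec n"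
  shows "(M *\<^sub>v y) \<bullet>c x = cnj ((M *\<^sub>v x) \<bullet>c y)"
proof -
  have M: "M $$ (j, i) = cnj (M $$ (i, j))" if "i < n" "j < n" for i j
    using assms(2) hermitian_mat_iff[OF assms(1)] that by blast
  have "cnj ((M *\<^sub>v x) \<bullet>c y) = (\<Sum>i<n. \<Sum>j<n. cnj (M $$ (i, j)) * cnj (x $ j) * y $ i)"
    by (simp add: sesquilinear_sum[OF assms(1,3,4)])
  also have "\<dots> = (\<Sum>j<n. \<Sum>i<n. cnj (M $$ (i, j)) * cnj (x $ j) * y $ i)"
    by (rule sum.swap)
  also have "\<dots> = (M *\<^sub>v y) \<bullet>c x"
    unfolding sesquilinear_sum[OF assms(1,4,3)]
    by (intro sum.cong refl) (simp add: M[symmetric] mult_ac)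
  finally show ?thesis ..
qed

text \<open>The two mixed terms are conjugate to each other by
  \<open>hermitian_form_commute\<close>, so together they give twice a real part. It is the only
  term that sees the phase of \<open>k\<close>.\<close>

lemma qform_add_smult:
  assumes M: "M \<in> carrier_mat n n" "hermitian_mat M"
    and x: "x \<in> carrier_vec n" and y: "y \<in> carrier_vec n"
  shows "qform M (x + k \<cdot>\<^sub>v y) =
    qform M x + 2 * Re (cnj k * ((M *\<^sub>v x) \<bullet>c y)) + (cmod k)\<^sup>2 * qform M y"
proof -
  have Mx: "M *\<^sub>v x \<in> carrier_vec n" and My: "M *\<^sub>v y \<in> carrier_vec n" using M x y by auto
  have "(M *\<^sub>v (x + k \<cdot>\<^sub>v y)) \<bullet>c (x + k \<cdot>\<^sub>v y) =
      (M *\<^sub>v x + k \<cdot>\<^sub>v (M *\<^sub>v y)) \<bullet> (conjugate x + cnj k \<cdot>\<^sub>v conjugate y)"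
    using M x y by (simp add: mult_add_distrib_mat_vec mult_mat_vec conjugate_add_vec[of _ n] conjugate_smult_vec)
  also have "\<dots> = (M *\<^sub>v x) \<bullet>c x + cnj k * ((M *\<^sub>v x) \<bullet>c y)
      + (k * ((M *\<^sub>v y) \<bullet>c x) + k * cnj k * ((M *\<^sub>v y) \<bullet>c y))"
    using Mx My x y
    by (simp add: add_scalar_prod_distrib[of _ n] scalar_prod_add_distrib[of _ n] algebra_simps)
  also have "k * ((M *\<^sub>v y) \<bullet>c x) = cnj (cnj k * ((M *\<^sub>v x) \<bullet>c y))"
    using hermitian_form_commute[OF M x y] by simp
  also have "k * cnj k = complex_of_real ((cmod k)\<^sup>2)"
    by (simp add: complex_norm_square del: of_real_power)
  finally show ?thesis
    unfolding qform_def by (simp del: of_real_power complex_cnj_mult)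
qed

lemma qform_smult:
  assumes "M \<in> carrier_mat n n" "x \<in> carrier_vec n"
  shows "qform M (k \<cdot>\<^sub>v x) = (cmod k)\<^sup>2 * qform M x"
proof -
  have Mx: "M *\<^sub>v x \<in> carrier_vec n" using assms by auto
  have "(M *\<^sub>v (k \<cdot>\<^sub>v x)) \<bullet>c (k \<cdot>\<^sub>v x) = k * cnj k * ((M *\<^sub>v x) \<bullet>c x)"
    using assms Mx by (simp add: mult_mat_vec conjugate_smult_vec)
  also have "k * cnj k = complex_of_real ((cmod k)\<^sup>2)"
    by (simp add: complex_norm_square del: of_real_power)
  finally show ?thesis
    unfolding qform_def by (simp del: of_real_power)
qed

lemma qform_add_smult_mat:
  assumes "M \<in> carrier_mat n n" "N \<in> carrier_mat n n" "x \<in> carrier_vec n"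
  shows "qform (M + complex_of_real r \<cdot>\<^sub>m N) x = qform M x + r * qform N x"
proof -
  have "M *\<^sub>v x \<in> carrier_vec n" "N *\<^sub>v x \<in> carrier_vec n" using assms by auto
  moreover have "(complex_of_real r \<cdot>\<^sub>m N) *\<^sub>v x = complex_of_real r \<cdot>\<^sub>v (N *\<^sub>v x)"
    using assms by (intro eq_vecI) auto
  ultimately show ?thesis
    using assms unfolding qform_def
    by (simp add: add_mult_distrib_mat_vec[of _ n n] add_scalar_prod_distrib[of _ n])
qed

text \<open>The value equals its own conjugate. This leads back from the real-valued
  \<open>qform\<close> to the complex equations required by \<open>eigenvalue_2D\<close>.\<close>

lemma hermitian_form_real:
  assumes "M \<in> carrier_mat n n" "hermitian_mat M" "x \<in> carrier_vec n"
  shows "(M *\<^sub>v x) \<bullet>c x = complex_of_real (qform M x)"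
  using hermitian_form_commute[OF assms assms(3)] unfolding qform_def
  by (metis Reals_cnj_iff of_real_Re)

lemma qform_one_eq_sum:
  assumes "x \<in> carrier_vec n"
  shows "qform (1\<^sub>m n) x = (\<Sum>i<n. (cmod (x $ i))\<^sup>2)"
proof -
  have "x \<bullet>c x = (\<Sum>i<n. x $ i * cnj (x $ i))"
    using assms by (auto simp: scalar_prod_def atLeast0LessThan intro!: sum.cong)
  then show ?thesis
    using assms by (simp add: qform_def complex_norm_square[symmetric] Re_sum flip: of_real_power)
qed

lemma qform_one_pos:
  assumes "x \<in> carrier_vec n" "x \<noteq> 0\<^sub>v n"
  shows "qform (1\<^sub>m n) x > 0"
  using conjugate_square_greater_0_vec[OF assms(1)] assms
  by (auto simp: qform_def less_complex_def)

lemma qform_eigenvector: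
  assumes "M \<in> carrier_mat n n" "eigenvalue M (complex_of_real a)"
  obtains x where "x \<in> carrier_vec n" "x \<noteq> 0\<^sub>v n" "qform M x = a * qform (1\<^sub>m n) x"
proof -
  from assms obtain x where x: "x \<in> carrier_vec n" "x \<noteq> 0\<^sub>v n" "M *\<^sub>v x = complex_of_real a \<cdot>\<^sub>v x"
    unfolding eigenvalue_def eigenvector_def by auto
  with that show thesis by (simp add: qform_def)
qed

section \<open>Isotropic vectors, the S-lemma and semidefinite kernels\<close>

text \<open>A quarter turn of \<open>s\<close>, rescaled to modulus \<open>\<bar>t\<bar>\<close>,
  makes \<open>cnj k * s\<close> purely imaginary. This removes a mixed term while the modulus of
  \<open>k\<close> stays free.\<close>

lemma ex_phase:
  fixes s :: complex and t :: real
  shows "\<exists>k. (cmod k)\<^sup>2 = t\<^sup>2 \<and> Re (cnj k * s) = 0"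
proof (cases "s = 0")
  case True
  then show ?thesis by (intro exI[of _ "complex_of_real t"]) simp
next
  case False
  define k where "k = complex_of_real (t / cmod s) * \<i> * s"
  have "cnj k * s = - \<i> * complex_of_real (t / cmod s) * (s * cnj s)"
    by (simp add: k_def)
  also have "s * cnj s = complex_of_real ((cmod s)\<^sup>2)"
    by (simp add: complex_norm_square del: of_real_power)
  finally have "Re (cnj k * s) = 0" by (simp del: of_real_power)
  moreover have "(cmod k)\<^sup>2 = t\<^sup>2" using False by (simp add: k_def norm_mult norm_divide)
  ultimately show ?thesis by blast
qed

text \<open>The modulus of \<open>k\<close> balances the positive value at \<open>x\<close> against
  the negative one at \<open>y\<close>, and its phase kills the mixed term. Replacing
  \<open>k\<close> by \<open>- k\<close> affects neither.\<close>

lemma ex_isotropic_pair: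
  assumes C: "C \<in> carrier_mat n n" "hermitian_mat C"
    and x: "x \<in> carrier_vec n" and y: "y \<in> carrier_vec n"
    and pos: "qform C x > 0" and neg: "qform C y < 0"
  obtains k where "(cmod k)\<^sup>2 = qform C x / - qform C y"
    "qform C (x + k \<cdot>\<^sub>v y) = 0" "qform C (x + (- k) \<cdot>\<^sub>v y) = 0"
proof -
  obtain k where k: "(cmod k)\<^sup>2 = (sqrt (qform C x / - qform C y))\<^sup>2"
    "Re (cnj k * ((C *\<^sub>v x) \<bullet>c y)) = 0"
    using ex_phase by blast
  have k2: "(cmod k)\<^sup>2 = qform C x / - qform C y"
    using k(1) pos neg by (simp add: divide_nonneg_neg)
  show thesis
  proof (rule that[OF k2])
    show "qform C (x + k \<cdot>\<^sub>v y) = 0"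
      using neg k(2) unfolding qform_add_smult[OF C x y] k2 by simp
    show "qform C (x + (- k) \<cdot>\<^sub>v y) = 0"
      using neg k(2) unfolding qform_add_smult[OF C x y] norm_minus_cancel k2 by simp
  qed
qed

text \<open>Dividing by \<open>qform C z\<close> turns the claim into bounds on ratios:
  \<open>\<mu>\<close> must be at least every ratio \<open>qform M y / qform C y\<close> with
  negative denominator and at most every one with positive denominator. The first kind never exceeds
  the second, so the supremum of the first kind serves; \<open>q\<close> makes that set nonempty and
  \<open>p\<close> bounds it.\<close>

lemma S_lemma:
  assumes M: "M \<in> carrier_mat n n" "hermitian_mat M"
    and C: "C \<in> carrier_mat n n" "hermitian_mat C"
    and p: "p \<in> carrier_vec n" "qform C p > 0"
    and q: "q \<in> carrier_vec n" "qform C q < 0"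
    and nonneg: "\<And>z. z \<in> carrier_vec n \<Longrightarrow> qform C z = 0 \<Longrightarrow> qform M z \<ge> 0"
  obtains \<mu> where "\<And>z. z \<in> carrier_vec n \<Longrightarrow> qform M z \<ge> \<mu> * qform C z"
proof -
  \<comment> \<open>Both \<open>x + k y\<close> and \<open>x - k y\<close> are isotropic for \<open>C\<close>; adding the two inequalities for
    \<open>M\<close> cancels the mixed terms.\<close>
  have le: "qform M y / qform C y \<le> qform M x / qform C x"
    if x: "x \<in> carrier_vec n" "qform C x > 0" and y: "y \<in> carrier_vec n" "qform C y < 0" for x y
  proof -
    obtain k where k: "(cmod k)\<^sup>2 = qform C x / - qform C y"
      "qform C (x + k \<cdot>\<^sub>v y) = 0" "qform C (x + (- k) \<cdot>\<^sub>v y) = 0"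
      using ex_isotropic_pair[OF C x(1) y(1) x(2) y(2)] .
    have "qform M (x + k \<cdot>\<^sub>v y) \<ge> 0" "qform M (x + (- k) \<cdot>\<^sub>v y) \<ge> 0"
      using nonneg k x y by auto
    then have "qform M x + (cmod k)\<^sup>2 * qform M y \<ge> 0"
      unfolding qform_add_smult[OF M x(1) y(1)] by simp
    then show ?thesis
      using x(2) y(2) unfolding k(1) by (simp add: field_simps)
  qed
  define S where "S = (\<lambda>y. qform M y / qform C y) ` {y \<in> carrier_vec n. qform C y < 0}"
  have ne: "S \<noteq> {}" using q unfolding S_def by blast
  have up: "Sup S \<le> qform M x / qform C x" if "x \<in> carrier_vec n" "qform C x > 0" for x
    by (rule cSup_least[OF ne]) (use le that in \<open>auto simp: S_def\<close>)
  have "bdd_above S"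
    by (rule bdd_aboveI[of _ "qform M p / qform C p"]) (use le p in \<open>auto simp: S_def\<close>)
  then have low: "qform M y / qform C y \<le> Sup S" if "y \<in> carrier_vec n" "qform C y < 0" for y
    by (intro cSup_upper) (use that in \<open>auto simp: S_def\<close>)
  show thesis
  proof (rule that)
    fix z :: "complex vec"
    assume z: "z \<in> carrier_vec n"
    consider "qform C z > 0" | "qform C z = 0" | "qform C z < 0" by linarith
    then show "Sup S * qform C z \<le> qform M z"
    proof cases
      case 1 with up[OF z] show ?thesis by (simp add: field_simps)
    next
      case 2 with nonneg[OF z] show ?thesis by simp
    next
      case 3 with low[OF z] show ?thesis by (simp add: field_simps)
    qed
  qed
qed

text \<open>If \<open>w = M x\<close> were nonzero, moving from \<open>x\<close> to
  \<open>x - t w\<close> would change the form by a negative term linear in \<open>t\<close> and a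
  term quadratic in \<open>t\<close>, so a small positive \<open>t\<close> would make it
  negative.\<close>

lemma psd_kernel:
  assumes M: "M \<in> carrier_mat n n" "hermitian_mat M"
    and psd: "\<And>z. z \<in> carrier_vec n \<Longrightarrow> qform M z \<ge> 0"
    and x: "x \<in> carrier_vec n" "qform M x = 0"
  shows "M *\<^sub>v x = 0\<^sub>v n"
proof (rule ccontr)
  define w where "w = M *\<^sub>v x"
  assume "M *\<^sub>v x \<noteq> 0\<^sub>v n"
  moreover have w: "w \<in> carrier_vec n" using M x by (simp add: w_def)
  ultimately have pos: "qform (1\<^sub>m n) w > 0" by (intro qform_one_pos) (auto simp: w_def)
  \<comment> \<open>With this \<open>t\<close> the quadratic term is at most half the size of the
    linear one. The added 1 keeps the denominator positive when
    \<open>qform M w = 0\<close>.\<close>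
  define t where "t = qform (1\<^sub>m n) w / (qform M w + 1)"
  have Mw: "qform M w \<ge> 0" using psd[OF w] .
  have "w \<bullet>c w = complex_of_real (qform (1\<^sub>m n) w)"
    using hermitian_form_real[OF one_carrier_mat hermitian_mat_one w] w by simp
  then have "0 \<le> - 2 * t * qform (1\<^sub>m n) w + t\<^sup>2 * qform M w"
    using psd[of "x + complex_of_real (- t) \<cdot>\<^sub>v w"] x w
    unfolding qform_add_smult[OF M x(1) w] w_def[symmetric] by simp
  also have "\<dots> = t * (t * qform M w - 2 * qform (1\<^sub>m n) w)"
    by (simp add: power2_eq_square algebra_simps)
  also have "\<dots> < 0"
  proof (rule mult_pos_neg)
    show "t > 0" using pos Mw by (simp add: t_def)
    then have "t * qform M w < t * (qform M w + 1)" by (simp add: algebra_simps)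
    also have "\<dots> = qform (1\<^sub>m n) w" using Mw by (simp add: t_def)
    finally show "t * qform M w - 2 * qform (1\<^sub>m n) w < 0" using pos by simp
  qed
  finally show False by simp
qed

section \<open>Compactness and existence of a minimiser\<close>

text \<open>Vectors are parametrised by functions on the naturals, so that the product topology
  applies; the form is a polynomial in finitely many coordinates and their conjugates.\<close>

lemma continuous_on_qform_vec:
  assumes "M \<in> carrier_mat n n"
  shows "continuous_on UNIV (\<lambda>f. qform M (vec n f))"
proof -
  have "(\<lambda>f. qform M (vec n f)) = (\<lambda>f. Re (\<Sum>i<n. \<Sum>j<n. M $$ (i, j) * f j * cnj (f i)))"
    unfolding qform_def using assms by (simp add: sesquilinear_sum)
  then show ?thesis
    by (simp only:) (intro continuous_intros continuous_on_product_coordinates)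
qed

text \<open>Tychonoff's theorem, restated for the topology of the function type.\<close>

lemma compact_function_box:
  assumes "\<And>i. compact (S i :: 'b::topological_space set)"
  shows "compact (PiE UNIV S)"
  using compactin_PiE[of "\<lambda>_. euclidean" UNIV S] assms
  unfolding euclidean_product_topology by simp

lemma compact_complex_square: "compact {w. \<bar>Re w\<bar> \<le> 1 \<and> \<bar>Im w\<bar> \<le> 1}"
proof -
  have "{w. \<bar>Re w\<bar> \<le> 1 \<and> \<bar>Im w\<bar> \<le> 1}
      = (\<lambda>p. Complex (fst p) (snd p)) ` ({-1..1} \<times> {-1..1})"
    by (force simp: image_iff abs_le_iff complex_eq_iff)
  then show ?thesis
    by (auto intro!: compact_continuous_image continuous_intros compact_Times compact_Icc)
qed

lemma ex_minimizer:
  assumes A: "A \<in> carrier_mat n n" and C: "C \<in> carrier_mat n n"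
    and z: "z \<in> carrier_vec n" "qform C z = 0" "qform (1\<^sub>m n) z = 1"
  obtains x where "x \<in> carrier_vec n" "qform C x = 0" "qform (1\<^sub>m n) x = 1"
    "\<And>y. y \<in> carrier_vec n \<Longrightarrow> qform C y = 0 \<Longrightarrow> qform (1\<^sub>m n) y = 1 \<Longrightarrow> qform A x \<le> qform A y"
proof -
  \<comment> \<open>All coordinates are confined, also those from \<open>n\<close> on, which
    \<open>vec n\<close> ignores; otherwise the box would not be compact. The entries of a unit
    vector lie in this square.\<close>
  define B :: "(nat \<Rightarrow> complex) set" where "B = PiE UNIV (\<lambda>_. {w. \<bar>Re w\<bar> \<le> 1 \<and> \<bar>Im w\<bar> \<le> 1})"
  define K where "K = B \<inter> ({f. qform C (vec n f) = 0} \<inter> {f. qform (1\<^sub>m n) (vec n f) = 1})"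
  \<comment> \<open>The default 0 lies in the square, so padding a feasible vector stays inside
    \<open>B\<close>.\<close>
  define pad where "pad y = (\<lambda>i. if i < n then y $ i else 0)" for y :: "complex vec"
  have vec_pad: "vec n (pad y) = y" if "y \<in> carrier_vec n" for y
    using that by (auto simp: pad_def)
  have pad: "pad y \<in> K"
    if y: "y \<in> carrier_vec n" "qform C y = 0" "qform (1\<^sub>m n) y = 1" for y
  proof -
    have "cmod (y $ i) \<le> 1" if "i < n" for i
    proof -
      have "(cmod (y $ i))\<^sup>2 \<le> (\<Sum>i<n. (cmod (y $ i))\<^sup>2)"
        using that by (intro member_le_sum) auto
      then have "(cmod (y $ i))\<^sup>2 \<le> 1\<^sup>2"
        using y by (simp add: qform_one_eq_sum)
      then show ?thesis by (rule power2_le_imp_le) simp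
    qed
    then have "\<bar>Re (y $ i)\<bar> \<le> 1 \<and> \<bar>Im (y $ i)\<bar> \<le> 1" if "i < n" for i
      using that abs_Re_le_cmod abs_Im_le_cmod order_trans by meson
    then have "pad y \<in> B" by (auto simp: B_def pad_def PiE_iff)
    then show ?thesis using y vec_pad by (simp add: K_def)
  qed
  have "compact K"
    unfolding K_def B_def
    by (intro compact_Int_closed compact_function_box compact_complex_square closed_Int closed_Collect_eq
        continuous_on_qform_vec continuous_on_const C one_carrier_mat)
  moreover have "K \<noteq> {}" using pad[OF z] by blast
  ultimately obtain f where f: "f \<in> K" "\<And>g. g \<in> K \<Longrightarrow> qform A (vec n f) \<le> qform A (vec n g)"
    using continuous_attains_inf[of K "\<lambda>f. qform A (vec n f)"]
      continuous_on_subset[OF continuous_on_qform_vec[OF A]] by blast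
  show thesis
  proof (rule that)
    show "vec n f \<in> carrier_vec n" "qform C (vec n f) = 0" "qform (1\<^sub>m n) (vec n f) = 1"
      using f(1) by (auto simp: K_def)
    show "qform A (vec n f) \<le> qform A y"
      if "y \<in> carrier_vec n" "qform C y = 0" "qform (1\<^sub>m n) y = 1" for y
      using f(2)[OF pad[OF that]] vec_pad[OF that(1)] by simp
  qed
qed

section \<open>Normalisation and the existence of a 2D-eigenvalue\<close>

lemma qform_zero_vec: "M \<in> carrier_mat n n \<Longrightarrow> qform M (0\<^sub>v n) = 0"
  by (simp add: qform_def)

text \<open>This carries the minimality over unit vectors to all nonzero isotropic vectors. The last
  equation lets the factor \<open>r\<^sup>2\<close> be cancelled there.\<close>

lemma normalize_vec:
  assumes "z \<in> carrier_vec n" "z \<noteq> 0\<^sub>v n"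
  obtains r where "r > 0" "qform (1\<^sub>m n) (complex_of_real r \<cdot>\<^sub>v z) = 1"
    "r\<^sup>2 * qform (1\<^sub>m n) z = 1"
proof -
  have pos: "qform (1\<^sub>m n) z > 0" by (rule qform_one_pos[OF assms])
  define r where "r = 1 / sqrt (qform (1\<^sub>m n) z)"
  have r: "r > 0" "r\<^sup>2 * qform (1\<^sub>m n) z = 1" using pos by (auto simp: r_def power_divide)
  with assms that show thesis by (simp add: qform_smult[of _ n])
qed

theorem theorem5p3:
  fixes A C :: "complex mat" and n :: nat
  assumes "A \<in> carrier_mat n n" and "C \<in> carrier_mat n n"
    and "hermitian_mat A" and "hermitian_mat C"
    and "indefinite_mat C"
  shows "\<exists>\<mu> l :: real. eigenvalue_2D A C (\<mu>, l)"
proof -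
  note A = assms(1,3) and C = assms(2,4)
  have I: "1\<^sub>m n \<in> carrier_mat n n" by simp
  obtain a b where ab: "a > 0" "eigenvalue C (complex_of_real a)"
    "b < 0" "eigenvalue C (complex_of_real b)"
    using assms(5) unfolding indefinite_mat_def by blast
  obtain p where "p \<in> carrier_vec n" "p \<noteq> 0\<^sub>v n" "qform C p = a * qform (1\<^sub>m n) p"
    using qform_eigenvector[OF C(1) ab(2)] .
  with ab have p: "p \<in> carrier_vec n" "qform C p > 0" by (auto simp: qform_one_pos)
  obtain q where "q \<in> carrier_vec n" "q \<noteq> 0\<^sub>v n" "qform C q = b * qform (1\<^sub>m n) q"
    using qform_eigenvector[OF C(1) ab(4)] .
  with ab have q: "q \<in> carrier_vec n" "qform C q < 0" by (auto simp: qform_one_pos mult_neg_pos)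
  obtain k where k: "qform C (p + k \<cdot>\<^sub>v q) = 0"
    using ex_isotropic_pair[OF C p(1) q(1) p(2) q(2)] .
  \<comment> \<open>After scaling, this isotropic vector shows that the constraint set is
    nonempty.\<close>
  define z where "z = p + k \<cdot>\<^sub>v q"
  have z: "z \<in> carrier_vec n" using p q by (simp add: z_def)
  \<comment> \<open>Otherwise \<open>p\<close> would be a multiple of \<open>q\<close>, and the form
    of \<open>C\<close> could not take opposite signs at the two.\<close>
  have "z \<noteq> 0\<^sub>v n"
  proof
    assume "z = 0\<^sub>v n"
    then have "p = (- k) \<cdot>\<^sub>v q"
      using p(1) q(1) unfolding z_def by (auto simp: vec_eq_iff eq_neg_iff_add_eq_0)
    then have "qform C p = (cmod k)\<^sup>2 * qform C q"
      using qform_smult[OF C(1) q(1), of "- k"] by simp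
    with p(2) q(2) show False by (simp add: zero_less_mult_iff)
  qed
  then obtain r where r: "qform (1\<^sub>m n) (complex_of_real r \<cdot>\<^sub>v z) = 1"
    using normalize_vec[OF z] by blast
  obtain x where x: "x \<in> carrier_vec n" "qform C x = 0" "qform (1\<^sub>m n) x = 1"
    and min: "\<And>y. y \<in> carrier_vec n \<Longrightarrow> qform C y = 0 \<Longrightarrow> qform (1\<^sub>m n) y = 1
      \<Longrightarrow> qform A x \<le> qform A y"
    using ex_minimizer[OF A(1) C(1) _ _ r] z k qform_smult[OF C(1) z] by (auto simp: z_def)
  define l where "l = qform A x"
  define M where "M = A + complex_of_real (- l) \<cdot>\<^sub>m 1\<^sub>m n"
  have M: "M \<in> carrier_mat n n" "hermitian_mat M"
    unfolding M_def using A by (simp, intro hermitian_mat_add_smult[of _ n] hermitian_mat_one) auto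
  have qM: "qform M y = qform A y - l * qform (1\<^sub>m n) y" if "y \<in> carrier_vec n" for y
    unfolding M_def qform_add_smult_mat[OF A(1) I that] by simp
  \<comment> \<open>Both forms are homogeneous of degree two and isotropy survives scaling, so the
    minimum over unit vectors yields the inequality for every isotropic \<open>y\<close>.\<close>
  have "qform M y \<ge> 0" if y: "y \<in> carrier_vec n" "qform C y = 0" for y
  proof (cases "y = 0\<^sub>v n")
    case True
    then show ?thesis using M by (simp add: qform_zero_vec)
  next
    case False
    then obtain s where s: "s > 0" "qform (1\<^sub>m n) (complex_of_real s \<cdot>\<^sub>v y) = 1"
        "s\<^sup>2 * qform (1\<^sub>m n) y = 1"
      using normalize_vec[OF y(1)] by blast
    have "l \<le> s\<^sup>2 * qform A y"
      using min[OF _ _ s(2)] y qform_smult[OF C(1) y(1)] qform_smult[OF A(1) y(1)]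
      by (simp add: l_def)
    then have "s\<^sup>2 * (l * qform (1\<^sub>m n) y) \<le> s\<^sup>2 * qform A y"
      using s(3) by (metis mult.left_commute mult.right_neutral)
    then show ?thesis using s(1) by (simp add: qM[OF y(1)])
  qed
  then obtain \<mu> where \<mu>: "\<And>y. y \<in> carrier_vec n \<Longrightarrow> qform M y \<ge> \<mu> * qform C y"
    using S_lemma[OF M C p q] by blast
  define N where "N = M + complex_of_real (- \<mu>) \<cdot>\<^sub>m C"
  have "N *\<^sub>v x = 0\<^sub>v n"
  proof (rule psd_kernel)
    show "N \<in> carrier_mat n n" unfolding N_def using C by simp
    show "hermitian_mat N" unfolding N_def by (rule hermitian_mat_add_smult[OF M(1) C(1) M(2) C(2)])
    show "qform N y \<ge> 0" if "y \<in> carrier_vec n" for y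
      using \<mu>[OF that] unfolding N_def qform_add_smult_mat[OF M(1) C(1) that] by simp
    \<comment> \<open>Isotropy of \<open>x\<close> removes the \<open>\<mu>\<close> term, and
      \<open>qform A x = l\<close> with unit norm cancels the rest.\<close>
    show "qform N x = 0"
      unfolding N_def qform_add_smult_mat[OF M(1) C(1) x(1)] qM[OF x(1)] using x by (simp add: l_def)
  qed (rule x)
  moreover have "N = (A - complex_of_real \<mu> \<cdot>\<^sub>m C) + complex_of_real (- l) \<cdot>\<^sub>m 1\<^sub>m n"
    unfolding N_def M_def using A C by (intro eq_matI) auto
  moreover have "(complex_of_real (- l) \<cdot>\<^sub>m 1\<^sub>m n) *\<^sub>v x = complex_of_real (- l) \<cdot>\<^sub>v x"
    using x by (intro eq_vecI) auto
  moreover have "A - complex_of_real \<mu> \<cdot>\<^sub>m C \<in> carrier_mat n n"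
    "complex_of_real (- l) \<cdot>\<^sub>m 1\<^sub>m n \<in> carrier_mat n n"
    using A C by auto
  ultimately have eq: "(A - complex_of_real \<mu> \<cdot>\<^sub>m C) *\<^sub>v x + complex_of_real (- l) \<cdot>\<^sub>v x = 0\<^sub>v n"
    using add_mult_distrib_mat_vec x(1) by metis
  have "(A - complex_of_real \<mu> \<cdot>\<^sub>m C) *\<^sub>v x = complex_of_real l \<cdot>\<^sub>v x"
  proof (rule eq_vecI)
    fix i assume "i < dim_vec (complex_of_real l \<cdot>\<^sub>v x)"
    then show "((A - complex_of_real \<mu> \<cdot>\<^sub>m C) *\<^sub>v x) $ i = (complex_of_real l \<cdot>\<^sub>v x) $ i"
      using arg_cong[OF eq, of "\<lambda>v. v $ i"] A C x by simp
  qed (use A C x in auto)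
  moreover have "(C *\<^sub>v x) \<bullet>c x = 0"
    using hermitian_form_real[OF C x(1)] x by simp
  moreover have "x \<bullet>c x = 1"
    using hermitian_form_real[OF I hermitian_mat_one x(1)] x by simp
  ultimately show ?thesis
    unfolding eigenvalue_2D_def using A(1) x(1) by auto
qed

end
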